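(* Let $\mathcal{F}=\{f_i:\mathbb{R}^s\to\mathbb{R}^s\}_{i\in\mathcal{I}}$ be a system of contracting similarities with attractor $K$. If $\mathcal{F}$ satisfies the weak separation condition for differences, then $$\mathrm{d}_A(K-K)\le 2\,\mathrm{d}_A(K),$$ where $K-K=\{x-y: x,y\in K\}$ and $\mathrm{d}_A$ denotes the Assouad dimension.
   Context: System of contracting similarities: a finite family $\{f_i:\mathbb{R}^s\to\mathbb{R}^s\}_{i\in\mathcal{I}}$, $\mathcal{I}=\{1,\dots,|\mathcal{I}|\}$, such that for each $i$ there is $0<c_i<1$ with $|f_i(x)-f_i(y)|=c_i|x-y|$ for all $x,y$. Its attractor is the unique non-empty compact set $K$ with $K=\bigcup_{i\in\mathcal{I}}f_i(K)$. Words: $\mathcal{I}^*=\bigcup_{k\ge1}\mathcal{I}^k$. For $\alpha=(i_1,\dots,i_k)\in\mathcal{I}^*$, $f_\alpha=f_{i_1}\circ\cdots\circ f_{i_k}$, $c_\alpha=c_{i_1}\cdots c_{i_k}$, $\bar\alpha=(i_1,\dots,i_{k-1})$ (with $c_{\bar\alpha}=1$ if $k=1$). For $0<b<1$, $I_b=\{\alpha\in\mathcal{I}^*: c_\alpha\le b<c_{\bar\alpha}\}$. Weak separation condition for differences: there exist $M\in\mathbb{N}$, $\epsilon>0$ and points $x_0,\dots,x_M\in K$ such that for every $0<b<1$ and all $\alpha,\beta,\gamma,\delta\in I_b$, either $f_\alpha(K)-f_\beta(K)=f_\gamma(K)-f_\delta(K)$ (as sets, where $A-B=\{a-b:a\in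 A,b\in B\}$), or $|f_\alpha(x_i)-f_\beta(x_j)-f_\gamma(x_i)+f_\delta(x_j)|\ge\epsilon b$ for some $i,j\le M$ depending on $\alpha,\beta,\gamma,\delta$. Assouad dimension: a subset $V$ of a metric space is $(M,s)$-homogeneous if $N(V\cap B(x,r),\rho)\le M(r/\rho)^s$ for all $x\in V$ and $r>\rho>0$, where $N(A,\rho)$ is the minimum number of balls of radius $\rho$ with centres in $A$ needed to cover $A$. $\mathrm{d}_A(V)$ is the infimum of all $s>0$ such that $V$ is $(M,s)$-homogeneous for some $M>0$. *)

theory Defs
  imports "HOL-Analysis.Analysis"
begin

definition contracting_similarities ::
    "nat \<Rightarrow> (nat \<Rightarrow> 'a::metric_space \<Rightarrow> 'a) \<Rightarrow> (nat \<Rightarrow> real) \<Rightarrow> bool" where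
  "contracting_similarities n f c \<longleftrightarrow>
     (\<forall>i\<in>{1..n}. 0 < c i \<and> c i < 1 \<and> (\<forall>x y. dist (f i x) (f i y) = c i * dist x y))"

text \<open>For contractions of a complete space and \<open>n \<ge> 1\<close> there is exactly one such set; for
  \<open>n = 0\<close> there is none.\<close>

definition is_attractor :: "nat \<Rightarrow> (nat \<Rightarrow> 'a::metric_space \<Rightarrow> 'a) \<Rightarrow> 'a set \<Rightarrow> bool" where
  "is_attractor n f K \<longleftrightarrow> K \<noteq> {} \<and> compact K \<and> K = (\<Union>i\<in>{1..n}. f i ` K)"

definition words :: "nat \<Rightarrow> nat list set" where
  "words n = {\<alpha>. \<alpha> \<noteq> [] \<and> set \<alpha> \<subseteq> {1..n}}"

definition word_map :: "(nat \<Rightarrow> 'a \<Rightarrow> 'a) \<Rightarrow> nat list \<Rightarrow> 'a \<Rightarrow> 'a" where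
  "word_map f \<alpha> = foldr (\<lambda>i g. f i \<circ> g) \<alpha> id"

definition word_ratio :: "(nat \<Rightarrow> real) \<Rightarrow> nat list \<Rightarrow> real" where
  "word_ratio c \<alpha> = prod_list (map c \<alpha>)"

definition cut_words :: "nat \<Rightarrow> (nat \<Rightarrow> real) \<Rightarrow> real \<Rightarrow> nat list set" where
  "cut_words n c b = {\<alpha> \<in> words n. word_ratio c \<alpha> \<le> b \<and> b < word_ratio c (butlast \<alpha>)}"

text \<open>The Minkowski difference, as opposed to the set-theoretic difference \<open>A - B\<close>.\<close>

definition diff_set :: "'a::minus set \<Rightarrow> 'a set \<Rightarrow> 'a set" where
  "diff_set A B = {a - b |a b. a \<in> A \<and> b \<in> B}"

definition weak_separation_differences ::
    "nat \<Rightarrow> (nat \<Rightarrow> 'a::real_normed_vector \<Rightarrow> 'a) \<Rightarrow> (nat \<Rightarrow> real) \<Rightarrow> 'a set \<Rightarrow> bool" where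
  "weak_separation_differences n f c K \<longleftrightarrow>
     (\<exists>(M::nat) (\<epsilon>::real) (x::nat \<Rightarrow> 'a). \<epsilon> > 0 \<and> (\<forall>i\<le>M. x i \<in> K) \<and>
        (\<forall>b. 0 < b \<and> b < 1 \<longrightarrow>
          (\<forall>\<alpha>\<in>cut_words n c b. \<forall>\<beta>\<in>cut_words n c b. \<forall>\<gamma>\<in>cut_words n c b. \<forall>\<delta>\<in>cut_words n c b.
             diff_set (word_map f \<alpha> ` K) (word_map f \<beta> ` K) =
               diff_set (word_map f \<gamma> ` K) (word_map f \<delta> ` K) \<or>
             (\<exists>i\<le>M. \<exists>j\<le>M.
                norm (word_map f \<alpha> (x i) - word_map f \<beta> (x j)
                      - word_map f \<gamma> (x i) + word_map f \<delta> (x j)) \<ge> \<epsilon> * b))))"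

text \<open>The value is \<open>\<infinity>\<close> if \<open>A\<close> has no finite cover by balls of radius \<open>\<rho>\<close> centred in \<open>A\<close>. Balls are
  open here and in the definition of homogeneity; closed balls give the same dimension.\<close>

definition covering_number :: "'a::metric_space set \<Rightarrow> real \<Rightarrow> enat" where
  "covering_number A \<rho> =
     (INF C\<in>{C. finite C \<and> C \<subseteq> A \<and> A \<subseteq> (\<Union>y\<in>C. ball y \<rho>)}. enat (card C))"

definition homogeneous :: "real \<Rightarrow> real \<Rightarrow> 'a::metric_space set \<Rightarrow> bool" where
  "homogeneous M s V \<longleftrightarrow>
     (\<forall>x\<in>V. \<forall>r \<rho>. 0 < \<rho> \<and> \<rho> < r \<longrightarrow>
        ereal_of_enat (covering_number (V \<inter> ball x r) \<rho>) \<le> ereal (M * (r / \<rho>) powr s))"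

text \<open>The infimum is taken in the extended reals, so that it is \<open>\<infinity>\<close> for a set that is not
  \<open>(M, s)\<close>-homogeneous for any \<open>M\<close> and \<open>s\<close>.\<close>

definition assouad_dim :: "'a::metric_space set \<Rightarrow> ereal" where
  "assouad_dim V = Inf {ereal s |s. s > 0 \<and> (\<exists>M>0. homogeneous M s V)}"

end

theory Submission
  imports Defs
begin

text \<open>Let \<open>K\<close> be \<open>(M, s)\<close>-homogeneous and let \<open>0 < b < 1\<close>. Every piece
  \<open>f\<^sub>\<alpha>(K) - f\<^sub>\<beta>(K)\<close> with \<open>\<alpha>, \<beta> \<in> I\<^sub>b\<close> is covered by the differences of the centres of
  a cover of \<open>f\<^sub>\<alpha>(K)\<close> and of one of \<open>f\<^sub>\<beta>(K)\<close>, hence by \<open>O((b/\<rho>)\<^sup>2\<^sup>s)\<close> balls of radius \<open>\<rho>\<close>.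
  The pieces that meet a given ball of radius \<open>b\<close> have all their points
  \<open>f\<^sub>\<alpha>(x\<^sub>i) - f\<^sub>\<beta>(x\<^sub>j)\<close> in a ball of radius \<open>O(b)\<close>, and for distinct pieces these
  configurations are \<open>\<epsilon> b\<close>-separated. By compactness the number of distinct pieces is therefore
  bounded independently of \<open>b\<close>, so that \<open>K - K\<close> is \<open>(M', 2s)\<close>-homogeneous.\<close>

section \<open>Finite covers by balls\<close>

text \<open>Unlike in \<open>covering_number\<close>, the centres may lie anywhere, so the notion
  passes to subsets. The bound \<open>L\<close> is real, so that expressions such as
  \<open>M * t powr s\<close> can be used directly.\<close>

definition ball_coverable :: "'a::metric_space set \<Rightarrow> real \<Rightarrow> real \<Rightarrow> bool" where
  "ball_coverable A \<rho> L \<longleftrightarrow> (\<exists>C. finite C \<and> A \<subseteq> (\<Union>y\<in>C. ball y \<rho>) \<and> real (card C) \<le> L)"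

lemma ball_coverable_mono:
  assumes "ball_coverable A \<rho> L" and "A' \<subseteq> A" and "\<rho> \<le> \<rho>'" and "L \<le> L'"
  shows "ball_coverable A' \<rho>' L'"
proof -
  obtain C where C: "finite C" "A \<subseteq> (\<Union>y\<in>C. ball y \<rho>)" "real (card C) \<le> L"
    using assms(1) unfolding ball_coverable_def by blast
  have "A' \<subseteq> (\<Union>y\<in>C. ball y \<rho>')"
    using C(2) assms(2) subset_ball[OF assms(3)] by blast
  with C assms(4) show ?thesis
    unfolding ball_coverable_def by (meson order_trans)
qed

lemma ball_coverable_Union:
  assumes "finite \<A>" and "real (card \<A>) \<le> N" and "0 \<le> L"
    and "\<And>A. A \<in> \<A> \<Longrightarrow> ball_coverable A \<rho> L"
  shows "ball_coverable (\<Union>\<A>) \<rho> (N * L)"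
proof -
  obtain C where C: "\<And>A. A \<in> \<A> \<Longrightarrow> finite (C A)"
      "\<And>A. A \<in> \<A> \<Longrightarrow> A \<subseteq> (\<Union>y\<in>C A. ball y \<rho>)"
      "\<And>A. A \<in> \<A> \<Longrightarrow> real (card (C A)) \<le> L"
    using assms(4) unfolding ball_coverable_def by metis
  have "real (card (\<Union>(C ` \<A>))) \<le> real (\<Sum>A\<in>\<A>. card (C A))"
    using card_UN_le[OF assms(1)] by (intro of_nat_mono) blast
  also have "\<dots> = (\<Sum>A\<in>\<A>. real (card (C A)))" by simp
  also have "\<dots> \<le> real (card \<A>) * L" using C(3) by (rule sum_bounded_above)
  also have "\<dots> \<le> N * L" using assms(2,3) by (rule mult_right_mono)
  finally have "real (card (\<Union>(C ` \<A>))) \<le> N * L" .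
  moreover have "finite (\<Union>(C ` \<A>))" using assms(1) C(1) by blast
  moreover have "\<Union>\<A> \<subseteq> (\<Union>y\<in>\<Union>(C ` \<A>). ball y \<rho>)" using C(2) by fastforce
  ultimately show ?thesis unfolding ball_coverable_def by blast
qed

lemma ball_coverable_image:
  assumes "ball_coverable A \<rho> L" and "\<And>x y. dist (g x) (g y) = a * dist x y" and "0 < a"
  shows "ball_coverable (g ` A) (a * \<rho>) L"
proof -
  obtain C where C: "finite C" "A \<subseteq> (\<Union>y\<in>C. ball y \<rho>)" "real (card C) \<le> L"
    using assms(1) unfolding ball_coverable_def by blast
  have "real (card (g ` C)) \<le> L"
    using card_image_le[OF C(1), of g] C(3) by linarith
  moreover have "g ` A \<subseteq> (\<Union>y\<in>g ` C. ball y (a * \<rho>))"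
    using C(2) assms(2,3) by fastforce
  ultimately show ?thesis unfolding ball_coverable_def using C(1) by blast
qed

lemma dist_diff_le:
  fixes a b y z :: "'a::real_normed_vector"
  shows "dist (y - z) (a - b) \<le> dist y a + dist z b"
  using norm_triangle_ineq4[of "y - a" "z - b"] by (simp add: dist_norm algebra_simps)

text \<open>Under differences the radii add and the numbers of centres multiply. The square is the
  source of the factor 2 in the dimension bound: \<open>t powr s\<close> becomes
  \<open>t powr (2 * s)\<close>.\<close>

lemma ball_coverable_diff_set:
  fixes A B :: "'a::real_normed_vector set"
  assumes "ball_coverable A \<rho> L" and "ball_coverable B \<rho> L"
  shows "ball_coverable (diff_set A B) (2 * \<rho>) (L\<^sup>2)"
proof -
  obtain C where C: "finite C" "A \<subseteq> (\<Union>y\<in>C. ball y \<rho>)" "real (card C) \<le> L"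
    using assms(1) unfolding ball_coverable_def by blast
  obtain D where D: "finite D" "B \<subseteq> (\<Union>y\<in>D. ball y \<rho>)" "real (card D) \<le> L"
    using assms(2) unfolding ball_coverable_def by blast
  let ?E = "(\<lambda>(y, z). y - z) ` (C \<times> D)"
  have "card ?E \<le> card C * card D"
    using card_image_le[of "C \<times> D"] C(1) D(1) by (metis card_cartesian_product finite_cartesian_product)
  then have "real (card ?E) \<le> real (card C) * real (card D)"
    by (metis of_nat_le_iff of_nat_mult)
  also have "\<dots> \<le> L\<^sup>2"
    unfolding power2_eq_square using C(3) D(3) by (intro mult_mono) auto
  finally have "real (card ?E) \<le> L\<^sup>2" .
  moreover have "diff_set A B \<subseteq> (\<Union>y\<in>?E. ball y (2 * \<rho>))"
  proof
    fix p assume "p \<in> diff_set A B"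
    then obtain a b where ab: "p = a - b" "a \<in> A" "b \<in> B" unfolding diff_set_def by blast
    obtain y where y: "y \<in> C" "dist y a < \<rho>" using C(2) ab(2) by auto
    obtain z where z: "z \<in> D" "dist z b < \<rho>" using D(2) ab(3) by auto
    have "dist (y - z) p \<le> dist y a + dist z b"
      unfolding ab(1) by (rule dist_diff_le)
    then have "p \<in> ball (y - z) (2 * \<rho>)" using y z by simp
    then show "p \<in> (\<Union>y\<in>?E. ball y (2 * \<rho>))" using y z by blast
  qed
  moreover have "finite ?E" using C(1) D(1) by blast
  ultimately show ?thesis unfolding ball_coverable_def by blast
qed

lemma ball_coverable_of_covering_number:
  assumes "ereal_of_enat (covering_number A \<rho>) \<le> ereal L"
  shows "ball_coverable A \<rho> L"
proof -
  let ?S = "{C. finite C \<and> C \<subseteq> A \<and> A \<subseteq> (\<Union>y\<in>C. ball y \<rho>)}"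
  have ne: "?S \<noteq> {}"
  proof
    assume "?S = {}"
    \<comment> \<open>An infimum over the empty family is the top element of \<open>enat\<close>,
      which exceeds every real bound.\<close>
    then have "covering_number A \<rho> = \<infinity>"
      unfolding covering_number_def by (simp only: image_empty) (simp add: top_enat_def)
    then show False using assms by simp
  qed
  then obtain e where "e \<in> (\<lambda>C. enat (card C)) ` ?S" by blast
  \<comment> \<open>Over a non-empty family the infimum in \<open>enat\<close> is a least element,
    so some cover attains it.\<close>
  then have "covering_number A \<rho> \<in> (\<lambda>C. enat (card C)) ` ?S"
    unfolding covering_number_def Inf_enat_def by (auto intro: LeastI)
  then obtain C where "C \<in> ?S" "covering_number A \<rho> = enat (card C)" by blast
  then show ?thesis using assms unfolding ball_coverable_def by auto
qed

text \<open>Moving the centres into the set costs a factor of two in the radius.\<close>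

lemma covering_number_le:
  assumes "ball_coverable A (\<rho> / 2) L"
  shows "ereal_of_enat (covering_number A \<rho>) \<le> ereal L"
proof -
  obtain C where C: "finite C" "A \<subseteq> (\<Union>y\<in>C. ball y (\<rho> / 2))" "real (card C) \<le> L"
    using assms unfolding ball_coverable_def by blast
  \<comment> \<open>Balls missing \<open>A\<close> are discarded; each remaining one contains a
    point of \<open>A\<close> that can replace its centre.\<close>
  define C' where "C' = {y\<in>C. A \<inter> ball y (\<rho> / 2) \<noteq> {}}"
  have "\<forall>y\<in>C'. \<exists>p. p \<in> A \<and> dist y p < \<rho> / 2" unfolding C'_def by auto
  then obtain p where p: "\<And>y. y \<in> C' \<Longrightarrow> p y \<in> A \<and> dist y (p y) < \<rho> / 2" by metis
  have "A \<subseteq> (\<Union>y\<in>p ` C'. ball y \<rho>)"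
  proof
    fix a assume a: "a \<in> A"
    then obtain y where y: "y \<in> C" "dist y a < \<rho> / 2" using C(2) by auto
    then have y': "y \<in> C'" using a unfolding C'_def by auto
    have "dist (p y) a < \<rho>"
      using p[OF y'] y(2) dist_triangle[of "p y" a y] by (simp add: dist_commute)
    then show "a \<in> (\<Union>y\<in>p ` C'. ball y \<rho>)" using y' by auto
  qed
  moreover have "finite C'" using C(1) unfolding C'_def by simp
  moreover have "p ` C' \<subseteq> A" using p by blast
  ultimately have "covering_number A \<rho> \<le> enat (card (p ` C'))"
    unfolding covering_number_def by (intro INF_lower) simp
  then have "ereal_of_enat (covering_number A \<rho>) \<le> ereal_of_enat (enat (card (p ` C')))"
    by (simp only: ereal_of_enat_le_iff)
  also have "\<dots> = ereal (real (card (p ` C')))" by simp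
  also have "\<dots> \<le> ereal L"
  proof -
    have "card (p ` C') \<le> card C'" using \<open>finite C'\<close> by (rule card_image_le)
    also have "\<dots> \<le> card C" unfolding C'_def using C(1) by (intro card_mono) auto
    finally show ?thesis using C(3) by simp
  qed
  finally show ?thesis .
qed

text \<open>Homogeneity is applied to a single ball containing all of \<open>K\<close>. The majorant
  \<open>t\<close> of \<open>R / \<delta>\<close> gives one bound that is also valid for large
  \<delta>, where homogeneity says nothing.\<close>

lemma homogeneous_ball_coverable:
  assumes "homogeneous M s K" and "x \<in> K" and "K \<subseteq> ball x R" and "0 < M" and "0 \<le> s"
    and "0 < \<delta>" and "R / \<delta> \<le> t" and "1 \<le> t"
  shows "ball_coverable K \<delta> (max 1 M * t powr s)"
proof (cases "\<delta> < R")
  case True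
  then have "ereal_of_enat (covering_number (K \<inter> ball x R) \<delta>) \<le> ereal (M * (R / \<delta>) powr s)"
    using assms(1,2,6) unfolding homogeneous_def by blast
  then have "ball_coverable (K \<inter> ball x R) \<delta> (M * (R / \<delta>) powr s)"
    by (rule ball_coverable_of_covering_number)
  moreover have "M * (R / \<delta>) powr s \<le> max 1 M * t powr s"
    using assms True by (intro mult_mono powr_mono2) auto
  ultimately show ?thesis
    using assms(3) by (elim ball_coverable_mono) auto
next
  \<comment> \<open>One ball suffices here; \<open>max 1 M\<close> and \<open>1 \<le> t\<close> keep
    the claimed bound at least 1.\<close>
  case False
  then have "K \<subseteq> (\<Union>y\<in>{x}. ball y \<delta>)" using assms(3) by fastforce
  moreover have "1 * 1 \<le> max 1 M * t powr s"
    using assms by (intro mult_mono ge_one_powr_ge_zero) auto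
  ultimately show ?thesis
    unfolding ball_coverable_def by (intro exI[of _ "{x}"]) auto
qed

section \<open>Words\<close>

lemma word_map_Nil [simp]: "word_map f [] = id"
  and word_map_Cons [simp]: "word_map f (i # \<alpha>) = f i \<circ> word_map f \<alpha>"
  by (simp_all add: word_map_def)

lemma word_map_append: "word_map f (\<alpha> @ \<beta>) = word_map f \<alpha> \<circ> word_map f \<beta>"
  by (induction \<alpha>) (auto simp: comp_assoc)

lemma word_ratio_pos:
  assumes "contracting_similarities n f c" and "set \<alpha> \<subseteq> {1..n}"
  shows "0 < word_ratio c \<alpha>"
  using assms(2)
  by (induction \<alpha>) (use assms(1) in \<open>auto simp: word_ratio_def contracting_similarities_def\<close>)

lemma dist_word_map:
  assumes "contracting_similarities n f c" and "set \<alpha> \<subseteq> {1..n}"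
  shows "dist (word_map f \<alpha> x) (word_map f \<alpha> y) = word_ratio c \<alpha> * dist x y"
  using assms(2)
  by (induction \<alpha>) (use assms(1) in \<open>auto simp: word_ratio_def contracting_similarities_def\<close>)

text \<open>Non-negativity is carried along because the induction multiplies two
  inequalities.\<close>

lemma word_ratio_le_power:
  assumes "\<And>i. i \<in> {1..n} \<Longrightarrow> 0 \<le> c i \<and> c i \<le> q" and "0 \<le> q" and "set \<alpha> \<subseteq> {1..n}"
  shows "0 \<le> word_ratio c \<alpha> \<and> word_ratio c \<alpha> \<le> q ^ length \<alpha>"
  using assms(3)
proof (induction \<alpha>)
  case (Cons i \<alpha>)
  then show ?case
    using assms(1)[of i] assms(2) by (auto simp: word_ratio_def intro!: mult_mono)
qed (simp add: word_ratio_def)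

text \<open>The self-similarity of \<open>K\<close> extends an address of \<open>y\<close> letter by
  letter. The ratios shrink geometrically, and the first prefix with ratio at most \<open>b\<close>
  is a cut word.\<close>

lemma attractor_cut_word:
  assumes "contracting_similarities n f c" and "is_attractor n f K"
    and "0 < b" and "b < 1" and "y \<in> K"
  shows "\<exists>\<alpha>\<in>cut_words n c b. y \<in> word_map f \<alpha> ` K"
proof -
  have K: "K = (\<Union>i\<in>{1..n}. f i ` K)" and c: "\<And>i. i \<in> {1..n} \<Longrightarrow> 0 < c i \<and> c i < 1"
    using assms(1,2) unfolding is_attractor_def contracting_similarities_def by auto
  have ne: "{1..n} \<noteq> {}" using K assms(5) by (metis UN_empty empty_iff)
  define q where "q = Max (c ` {1..n})"
  have q: "c i \<le> q" if "i \<in> {1..n}" for i using that unfolding q_def by simp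
  have "q \<in> c ` {1..n}" unfolding q_def using ne by (intro Max_in) auto
  then have q01: "0 < q" "q < 1" using c by auto
  \<comment> \<open>Either the address has already been cut, or it has reached length
    \<open>k\<close> with ratio still above \<open>b\<close>. The empty word, of ratio
    \<open>1 > b\<close>, starts the induction although it is not in \<open>words n\<close>.\<close>
  have "\<exists>\<alpha>. set \<alpha> \<subseteq> {1..n} \<and> y \<in> word_map f \<alpha> ` K \<and>
      (\<alpha> \<in> cut_words n c b \<or> length \<alpha> = k \<and> b < word_ratio c \<alpha>)" for k
  proof (induction k)
    case 0
    show ?case
      by (rule exI[of _ "[]"]) (use assms(4,5) in \<open>auto simp: word_ratio_def\<close>)
  next
    case (Suc k)
    then obtain \<alpha> where \<alpha>: "set \<alpha> \<subseteq> {1..n}" "y \<in> word_map f \<alpha> ` K"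
      "\<alpha> \<in> cut_words n c b \<or> length \<alpha> = k \<and> b < word_ratio c \<alpha>" by blast
    show ?case
    proof (cases "\<alpha> \<in> cut_words n c b")
      case True
      then show ?thesis using \<alpha> by blast
    next
      case False
      obtain z where z: "z \<in> K" "y = word_map f \<alpha> z" using \<alpha>(2) by blast
      obtain i w where i: "i \<in> {1..n}" "w \<in> K" "z = f i w" using K z(1) by blast
      have "y = word_map f (\<alpha> @ [i]) w" using z i by (simp add: word_map_append)
      then have "y \<in> word_map f (\<alpha> @ [i]) ` K" using i by blast
      moreover have "set (\<alpha> @ [i]) \<subseteq> {1..n}" using \<alpha>(1) i(1) by simp
      \<comment> \<open>Since \<alpha> is the \<open>butlast\<close> of the new word and has ratio
        above \<open>b\<close>, the new word is cut as soon as its own ratio is at most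
        \<open>b\<close>.\<close>
      moreover have "\<alpha> @ [i] \<in> cut_words n c b \<or> b < word_ratio c (\<alpha> @ [i])"
        using \<alpha>(1,3) i(1) False unfolding cut_words_def words_def by auto
      ultimately show ?thesis using \<alpha>(3) False by (metis length_append_singleton)
    qed
  qed
  \<comment> \<open>At this length the uncut alternative would give \<open>b < q ^ k\<close>, a
    contradiction.\<close>
  moreover obtain k where "q ^ k < b"
    using real_arch_pow_inv[OF assms(3) q01(2)] by blast
  ultimately obtain \<alpha> where \<alpha>: "set \<alpha> \<subseteq> {1..n}" "y \<in> word_map f \<alpha> ` K"
    "\<alpha> \<in> cut_words n c b \<or> length \<alpha> = k \<and> b < word_ratio c \<alpha>" by blast
  have "word_ratio c \<alpha> \<le> q ^ length \<alpha>"
    using word_ratio_le_power[OF _ _ \<alpha>(1), of c q] c q q01 by (simp add: less_imp_le)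
  then have "\<alpha> \<in> cut_words n c b" using \<alpha>(3) \<open>q ^ k < b\<close> by auto
  then show ?thesis using \<alpha>(2) by blast
qed

section \<open>Counting pieces\<close>

text \<open>On \<open>P\<close> the map \<open>D\<close> factors through \<open>g\<close>, so its
  values are counted by codes in \<open>F\<close>. In this way distinct pieces can be counted
  without bounding the number of word pairs \<open>P\<close>.\<close>

lemma card_image_le_of_factor:
  assumes "finite F" and "g ` P \<subseteq> F"
    and "\<And>p p'. p \<in> P \<Longrightarrow> p' \<in> P \<Longrightarrow> g p = g p' \<Longrightarrow> D p = D p'"
  shows "finite (D ` P)" and "card (D ` P) \<le> card F"
proof -
  have "D p = (D \<circ> inv_into P g) (g p)" if "p \<in> P" for p
    using that by (auto intro!: assms(3) simp: inv_into_into f_inv_into_f)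
  then have "D ` P = (D \<circ> inv_into P g) ` g ` P" by (auto simp: image_iff)
  moreover have fin: "finite (g ` P)" using assms(1,2) by (rule finite_subset[rotated])
  ultimately show "finite (D ` P)" "card (D ` P) \<le> card F"
    using card_image_le[OF fin, of "D \<circ> inv_into P g"] card_mono[OF assms(1,2)] by simp_all
qed

text \<open>The elements are sets, not pairs of words: pairs with equal differences count once, in
  accordance with the first alternative of the separation condition.\<close>

definition pieces_meeting ::
    "nat \<Rightarrow> (nat \<Rightarrow> 'a::real_normed_vector \<Rightarrow> 'a) \<Rightarrow> (nat \<Rightarrow> real) \<Rightarrow> 'a set \<Rightarrow> real \<Rightarrow> 'a \<Rightarrow> 'a set set" where
  "pieces_meeting n f c K b x =
     {S. \<exists>\<alpha>\<in>cut_words n c b. \<exists>\<beta>\<in>cut_words n c b.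
        S = diff_set (word_map f \<alpha> ` K) (word_map f \<beta> ` K) \<and> S \<inter> ball x b \<noteq> {}}"

text \<open>A pigeonhole argument: the configuration of a pair of words, translated by
  \<open>x\<close> and scaled by \<open>1 / b\<close>, is rounded to a finite net. Pairs with equal
  roundings are too close to be separated and give the same piece, so the number of roundings bounds
  the number of pieces.\<close>

lemma card_pieces_bounded:
  fixes f :: "nat \<Rightarrow> 'a::euclidean_space \<Rightarrow> 'a"
  assumes sim: "contracting_similarities n f c" and "bounded K"
    and "weak_separation_differences n f c K"
  obtains N :: nat where "\<And>b x. 0 < b \<Longrightarrow> b < 1 \<Longrightarrow>
    finite (pieces_meeting n f c K b x) \<and> card (pieces_meeting n f c K b x) \<le> N"
proof -
  obtain m :: nat and \<epsilon> and X :: "nat \<Rightarrow> 'a"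
    where \<epsilon>: "\<epsilon> > 0" and X: "\<forall>i\<le>m. X i \<in> K"
      and sep: "\<forall>b. 0 < b \<and> b < 1 \<longrightarrow>
          (\<forall>\<alpha>\<in>cut_words n c b. \<forall>\<beta>\<in>cut_words n c b. \<forall>\<gamma>\<in>cut_words n c b. \<forall>\<delta>\<in>cut_words n c b.
             diff_set (word_map f \<alpha> ` K) (word_map f \<beta> ` K) =
               diff_set (word_map f \<gamma> ` K) (word_map f \<delta> ` K) \<or>
             (\<exists>i\<le>m. \<exists>j\<le>m.
                norm (word_map f \<alpha> (X i) - word_map f \<beta> (X j)
                      - word_map f \<gamma> (X i) + word_map f \<delta> (X j)) \<ge> \<epsilon> * b))"
    using assms(3) unfolding weak_separation_differences_def by (elim exE conjE) (rule that)
  define d where "d = diameter K"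
  have d: "dist u v \<le> d" if "u \<in> K" "v \<in> K" for u v
    unfolding d_def using diameter_bounded_bound[OF assms(2)] that by blast
  \<comment> \<open>The radius \<open>1 + 2 * d\<close> contains all rescaled configuration points.
    Mesh \<open>\<epsilon> / 2\<close> makes two points with a common net point less than \<epsilon>
    apart.\<close>
  obtain Q where Q: "finite Q" "cball (0::'a) (1 + 2 * d) \<subseteq> (\<Union>q\<in>Q. ball q (\<epsilon> / 2))"
    using compact_cball[of "0::'a" "1 + 2 * d"] half_gt_zero[OF \<epsilon>]
    unfolding compact_eq_totally_bounded by blast
  \<comment> \<open>A code assigns a net point to each index pair; \<open>F\<close> depends on
    neither \<open>b\<close> nor \<open>x\<close>.\<close>
  define F where "F = PiE ({..m} \<times> {..m}) (\<lambda>_. Q)"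
  have F: "finite F" unfolding F_def using Q(1) by (intro finite_PiE) auto
  have "finite (pieces_meeting n f c K b x) \<and> card (pieces_meeting n f c K b x) \<le> card F"
    if b: "0 < b" "b < 1" for b x
  proof -
    define D where "D = (\<lambda>(\<alpha>, \<beta>). diff_set (word_map f \<alpha> ` K) (word_map f \<beta> ` K))"
    define P where "P = {(\<alpha>, \<beta>) \<in> cut_words n c b \<times> cut_words n c b. D (\<alpha>, \<beta>) \<inter> ball x b \<noteq> {}}"
    define v where "v = (\<lambda>(\<alpha>, \<beta>) (i, j). word_map f \<alpha> (X i) - word_map f \<beta> (X j))"
    have near: "\<exists>q\<in>Q. dist (v p ij) (x + b *\<^sub>R q) < b * \<epsilon> / 2"
      if p: "p \<in> P" and ij: "ij \<in> {..m} \<times> {..m}" for p ij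
    proof -
      obtain \<alpha> \<beta> where \<alpha>\<beta>: "p = (\<alpha>, \<beta>)" "\<alpha> \<in> cut_words n c b" "\<beta> \<in> cut_words n c b"
        "D (\<alpha>, \<beta>) \<inter> ball x b \<noteq> {}" using p unfolding P_def by auto
      obtain i j where i: "ij = (i, j)" "i \<le> m" "j \<le> m" using ij by auto
      obtain u w where u: "u \<in> K" "w \<in> K" "dist x (word_map f \<alpha> u - word_map f \<beta> w) < b"
        using \<alpha>\<beta>(4) unfolding D_def diff_set_def by auto
      \<comment> \<open>The ratio of a cut word is at most \<open>b\<close>, so the image of
        \<open>K\<close> has diameter at most \<open>b * d\<close>.\<close>
      have small: "dist (word_map f \<tau> y) (word_map f \<tau> z) \<le> b * d"
        if "\<tau> \<in> cut_words n c b" "y \<in> K" "z \<in> K" for \<tau> y z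
      proof -
        have \<tau>: "set \<tau> \<subseteq> {1..n}" "word_ratio c \<tau> \<le> b"
          using that(1) unfolding cut_words_def words_def by auto
        have "dist (word_map f \<tau> y) (word_map f \<tau> z) = word_ratio c \<tau> * dist y z"
          by (rule dist_word_map[OF sim \<tau>(1)])
        also have "\<dots> \<le> b * d" using \<tau>(2) b d[OF that(2,3)] by (intro mult_mono) auto
        finally show ?thesis .
      qed
      have "dist x (v p ij) \<le> dist x (word_map f \<alpha> u - word_map f \<beta> w)
          + dist (word_map f \<alpha> u - word_map f \<beta> w) (v p ij)"
        by (rule dist_triangle)
      \<comment> \<open>The piece has a point within \<open>b\<close> of \<open>x\<close>; replacing
        \<open>u\<close> by \<open>X i\<close> and \<open>w\<close> by \<open>X j\<close> costs
        \<open>b * d\<close> each.\<close>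
      also have "\<dots> \<le> b + (b * d + b * d)"
      proof -
        have "dist (word_map f \<alpha> u - word_map f \<beta> w) (v p ij) \<le>
            dist (word_map f \<alpha> u) (word_map f \<alpha> (X i)) + dist (word_map f \<beta> w) (word_map f \<beta> (X j))"
          unfolding v_def \<alpha>\<beta>(1) i(1) prod.case by (rule dist_diff_le)
        also have "\<dots> \<le> b * d + b * d"
          using small \<alpha>\<beta>(2,3) u(1,2) X i(2,3) by (intro add_mono) auto
        finally show ?thesis using u(3) by linarith
      qed
      finally have "norm (v p ij - x) \<le> b * (1 + 2 * d)"
        by (simp add: dist_norm norm_minus_commute algebra_simps)
      then have "norm ((1 / b) *\<^sub>R (v p ij - x)) \<le> 1 + 2 * d"
        using b by (simp add: divide_le_eq mult.commute)
      then have "(1 / b) *\<^sub>R (v p ij - x) \<in> cball 0 (1 + 2 * d)" by simp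
      then obtain q where q: "q \<in> Q" "dist q ((1 / b) *\<^sub>R (v p ij - x)) < \<epsilon> / 2"
        using Q(2) by (meson UN_E mem_ball subsetD)
      have "v p ij - (x + b *\<^sub>R q) = b *\<^sub>R ((1 / b) *\<^sub>R (v p ij - x) - q)"
        using b by (simp add: algebra_simps)
      then have "dist (v p ij) (x + b *\<^sub>R q) = b * dist q ((1 / b) *\<^sub>R (v p ij - x))"
        using b by (simp add: dist_norm norm_minus_commute)
      also have "\<dots> < b * (\<epsilon> / 2)" using q(2) b by simp
      finally show ?thesis using q(1) by auto
    qed
    then obtain g where g: "\<And>p ij. p \<in> P \<Longrightarrow> ij \<in> {..m} \<times> {..m} \<Longrightarrow>
        g p ij \<in> Q \<and> dist (v p ij) (x + b *\<^sub>R g p ij) < b * \<epsilon> / 2"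
      by metis
    \<comment> \<open>Restriction makes the codes extensional, hence members of the finite set
      \<open>F\<close>.\<close>
    define G where "G p = restrict (g p) ({..m} \<times> {..m})" for p
    have sub: "G ` P \<subseteq> F"
      unfolding G_def F_def using g by (intro image_subsetI PiE_I) simp_all
    have same: "D p = D p'" if p: "p \<in> P" "p' \<in> P" and eq: "G p = G p'" for p p'
    proof -
      obtain \<alpha> \<beta> where \<alpha>\<beta>: "p = (\<alpha>, \<beta>)" "\<alpha> \<in> cut_words n c b" "\<beta> \<in> cut_words n c b"
        using p unfolding P_def by auto
      obtain \<gamma> \<delta> where \<gamma>\<delta>: "p' = (\<gamma>, \<delta>)" "\<gamma> \<in> cut_words n c b" "\<delta> \<in> cut_words n c b"
        using p unfolding P_def by auto
      \<comment> \<open>The vector is \<open>v p (i, j) - v p' (i, j)\<close>, and both terms lie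
        within \<open>b * \<epsilon> / 2\<close> of the same point. This rules out the second
        alternative of \<open>sep\<close>.\<close>
      have "norm (word_map f \<alpha> (X i) - word_map f \<beta> (X j)
          - word_map f \<gamma> (X i) + word_map f \<delta> (X j)) < \<epsilon> * b" if "i \<le> m" "j \<le> m" for i j
      proof -
        have ij: "(i, j) \<in> {..m} \<times> {..m}" using that by simp
        then have "g p (i, j) = g p' (i, j)"
          using fun_cong[OF eq, of "(i, j)"] unfolding G_def by simp
        then have "dist (v p (i, j)) (v p' (i, j)) < \<epsilon> * b"
          using g[OF p(1) ij] g[OF p(2) ij]
            dist_triangle2[of "v p (i, j)" "v p' (i, j)" "x + b *\<^sub>R g p (i, j)"]
          by (simp add: mult.commute)
        then show ?thesis
          unfolding v_def \<alpha>\<beta>(1) \<gamma>\<delta>(1) dist_norm by (simp add: algebra_simps)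
      qed
      then show ?thesis
        using sep[rule_format, OF conjI[OF b] \<alpha>\<beta>(2,3) \<gamma>\<delta>(2,3)] unfolding D_def \<alpha>\<beta>(1) \<gamma>\<delta>(1) by force
    qed
    have pieces: "pieces_meeting n f c K b x = D ` P"
      unfolding pieces_meeting_def D_def P_def by auto
    show ?thesis
      unfolding pieces using card_image_le_of_factor[OF F sub same] by (rule conjI)
  qed
  then show thesis by (rule that)
qed

section \<open>Homogeneity of the difference set\<close>

lemma diff_set_homogeneous:
  fixes f :: "nat \<Rightarrow> 'a::euclidean_space \<Rightarrow> 'a"
  assumes sim: "contracting_similarities n f c" and att: "is_attractor n f K"
    and wsd: "weak_separation_differences n f c K"
    and "0 < M" and "0 < s" and hom: "homogeneous M s K"
  shows "\<exists>M'>0. homogeneous M' (2 * s) (diff_set K K)"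
proof -
  have bdd: "bounded K" using att unfolding is_attractor_def by (simp add: compact_imp_bounded)
  obtain x0 where x0: "x0 \<in> K" using att unfolding is_attractor_def by blast
  obtain R0 where R0: "K \<subseteq> ball x0 R0" using bdd bounded_subset_ballD by blast
  define R where "R = max 1 R0"
  have R: "1 \<le> R" "K \<subseteq> ball x0 R" using R0 unfolding R_def by fastforce+
  obtain N :: nat where N: "\<And>b x. 0 < b \<Longrightarrow> b < 1 \<Longrightarrow>
    finite (pieces_meeting n f c K b x) \<and> card (pieces_meeting n f c K b x) \<le> N"
    using card_pieces_bounded[OF sim bdd wsd] by blast
  \<comment> \<open>\<open>Suc N\<close> keeps \<open>M'\<close> positive and leaves room for the
    single piece in the case \<open>r \<ge> 1\<close>.\<close>
  define M' where "M' = real (Suc N) * (max 1 M * (4 * R) powr s)\<^sup>2"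
  have "ereal_of_enat (covering_number (diff_set K K \<inter> ball x r) \<rho>) \<le> ereal (M' * (r / \<rho>) powr (2 * s))"
    if \<rho>: "0 < \<rho>" "\<rho> < r" for x r \<rho>
  proof -
    \<comment> \<open>This equals \<open>R / (\<rho> / (4 * r))\<close>, needed for
      \<open>r < 1\<close>, and dominates \<open>R / (\<rho> / 4)\<close> when
      \<open>r \<ge> 1\<close>.\<close>
    define t where "t = 4 * R * (r / \<rho>)"
    define L where "L = max 1 M * t powr s"
    have "1 \<le> r / \<rho>" using \<rho> by simp
    then have t: "1 \<le> t"
      unfolding t_def using R(1) mult_mono[of 1 "4 * R" 1 "r / \<rho>"] by simp
    have L0: "0 \<le> L" unfolding L_def by simp
    have "(r / \<rho>) powr (2 * s) = ((r / \<rho>) powr s)\<^sup>2"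
      by (simp add: power2_eq_square flip: powr_add)
    moreover have "t powr s = (4 * R) powr s * (r / \<rho>) powr s"
      unfolding t_def by (rule powr_mult)
    ultimately have M'L: "M' * (r / \<rho>) powr (2 * s) = real (Suc N) * L\<^sup>2"
      unfolding M'_def L_def by (simp add: power_mult_distrib)
    \<comment> \<open>Half the radius is reserved for moving the centres into the set. Taking
      differences doubles the radius as well, whence the covers of radius \<open>\<rho> / 4\<close>
      below.\<close>
    have "ball_coverable (diff_set K K \<inter> ball x r) (\<rho> / 2) (real (Suc N) * L\<^sup>2)"
    proof (cases "r < 1")
      case False
      have "R \<le> R * r" using False R(1) by simp
      then have "R / (\<rho> / 4) \<le> t" unfolding t_def using \<rho> by (simp add: field_simps)
      then have "ball_coverable K (\<rho> / 4) L"
        unfolding L_def using \<rho> assms(4,5) t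
        by (intro homogeneous_ball_coverable[OF hom x0 R(2)]) auto
      then have "ball_coverable (diff_set K K) (2 * (\<rho> / 4)) (L\<^sup>2)"
        by (intro ball_coverable_diff_set)
      moreover have "1 * L\<^sup>2 \<le> real (Suc N) * L\<^sup>2" by (intro mult_right_mono) auto
      ultimately show ?thesis by (elim ball_coverable_mono) auto
    next
      case True
      have r: "0 < r" using \<rho> by simp
      define \<S> where "\<S> = pieces_meeting n f c K r x"
      have \<S>: "finite \<S>" "card \<S> \<le> N" using N[OF r True, of x] unfolding \<S>_def by blast+
      \<comment> \<open>A cut word contracts by at most \<open>r\<close>, so a cover of
        \<open>K\<close> at radius \<open>\<rho> / (4 * r)\<close> is carried to one of its image at
        radius \<open>\<rho> / 4\<close>.\<close>
      have "R / (\<rho> / (4 * r)) \<le> t" unfolding t_def using \<rho> by (simp add: field_simps)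
      then have cover: "ball_coverable K (\<rho> / (4 * r)) L"
        unfolding L_def using \<rho> assms(4,5) t
        by (intro homogeneous_ball_coverable[OF hom x0 R(2)]) auto
      have piece: "ball_coverable (word_map f \<alpha> ` K) (\<rho> / 4) L" if "\<alpha> \<in> cut_words n c r" for \<alpha>
      proof -
        have \<alpha>: "set \<alpha> \<subseteq> {1..n}" "word_ratio c \<alpha> \<le> r"
          using that unfolding cut_words_def words_def by auto
        have "ball_coverable (word_map f \<alpha> ` K) (word_ratio c \<alpha> * (\<rho> / (4 * r))) L"
          using cover dist_word_map[OF sim \<alpha>(1)] word_ratio_pos[OF sim \<alpha>(1)]
          by (rule ball_coverable_image)
        moreover have "word_ratio c \<alpha> * (\<rho> / (4 * r)) \<le> r * (\<rho> / (4 * r))"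
          using \<alpha>(2) \<rho> by (intro mult_right_mono) auto
        then have "word_ratio c \<alpha> * (\<rho> / (4 * r)) \<le> \<rho> / 4" using r by simp
        ultimately show ?thesis by (elim ball_coverable_mono) auto
      qed
      have "ball_coverable S (\<rho> / 2) (L\<^sup>2)" if "S \<in> \<S>" for S
      proof -
        obtain \<alpha> \<beta> where "\<alpha> \<in> cut_words n c r" "\<beta> \<in> cut_words n c r"
          "S = diff_set (word_map f \<alpha> ` K) (word_map f \<beta> ` K)"
          using \<open>S \<in> \<S>\<close> unfolding \<S>_def pieces_meeting_def by blast
        then have "ball_coverable S (2 * (\<rho> / 4)) (L\<^sup>2)"
          using piece by (blast intro: ball_coverable_diff_set)
        then show ?thesis by simp
      qed
      then have "ball_coverable (\<Union>\<S>) (\<rho> / 2) (real (Suc N) * L\<^sup>2)"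
        using \<S> by (intro ball_coverable_Union) auto
      moreover have "diff_set K K \<inter> ball x r \<subseteq> \<Union>\<S>"
      proof
        fix p assume p: "p \<in> diff_set K K \<inter> ball x r"
        then obtain y z where yz: "p = y - z" "y \<in> K" "z \<in> K" unfolding diff_set_def by blast
        obtain \<alpha> where \<alpha>: "\<alpha> \<in> cut_words n c r" "y \<in> word_map f \<alpha> ` K"
          using attractor_cut_word[OF sim att r True yz(2)] by blast
        obtain \<beta> where \<beta>: "\<beta> \<in> cut_words n c r" "z \<in> word_map f \<beta> ` K"
          using attractor_cut_word[OF sim att r True yz(3)] by blast
        have "p \<in> diff_set (word_map f \<alpha> ` K) (word_map f \<beta> ` K)"
          using \<alpha>(2) \<beta>(2) yz(1) unfolding diff_set_def by blast
        then show "p \<in> \<Union>\<S>" using \<alpha>(1) \<beta>(1) p unfolding \<S>_def pieces_meeting_def by blast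
      qed
      ultimately show ?thesis by (elim ball_coverable_mono) auto
    qed
    then show ?thesis unfolding M'L by (rule covering_number_le)
  qed
  then have "homogeneous M' (2 * s) (diff_set K K)" unfolding homogeneous_def by blast
  moreover have "0 < M'" unfolding M'_def using R(1) by simp
  ultimately show ?thesis by blast
qed

theorem theorem3p4:
  fixes n :: nat
    and f :: "nat \<Rightarrow> real ^ 's \<Rightarrow> real ^ 's"
    and c :: "nat \<Rightarrow> real"
    and K :: "(real ^ 's) set"
  assumes "contracting_similarities n f c"
    and "is_attractor n f K"
    and "weak_separation_differences n f c K"
  shows "assouad_dim (diff_set K K) \<le> 2 * assouad_dim K"
proof -
  \<comment> \<open>Halving the left side turns the claim into a lower bound for all admissible
    exponents of \<open>K\<close>; this also covers the case that there are none and the infimum is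
    infinite.\<close>
  have "assouad_dim (diff_set K K) / 2 \<le> assouad_dim K"
    unfolding assouad_dim_def[of K]
  proof (rule Inf_greatest)
    fix e assume "e \<in> {ereal s |s. s > 0 \<and> (\<exists>M>0. homogeneous M s K)}"
    then obtain s M where s: "e = ereal s" "s > 0" "M > 0" "homogeneous M s K" by blast
    then have "\<exists>M'>0. homogeneous M' (2 * s) (diff_set K K)"
      using diff_set_homogeneous[OF assms] by blast
    then have "assouad_dim (diff_set K K) \<le> ereal (2 * s)"
      unfolding assouad_dim_def using s(2) by (intro Inf_lower) auto
    then show "assouad_dim (diff_set K K) / 2 \<le> e"
      unfolding s(1) by (cases "assouad_dim (diff_set K K)") auto
  qed
  then show ?thesis
    by (cases "assouad_dim (diff_set K K)"; cases "assouad_dim K") auto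
qed

end
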